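(* Let $\Omega$ be a convex subset of a Banach space $\mathbb{X}$ and let $(a_n)_{n\in\mathbb{N}}$, $(b_n)_{n\in\mathbb{N}}$ be two sequences in $[0,1]$. Assume that $T_1 \in \mathbf{Ne}_{\alpha_1}(\Omega)$, $T_2 \in \mathbf{Ne}_{\alpha_2}(\Omega)$ have a common fixed point $x^* \in \mathcal{F}(T_1, T_2)$ for some $\alpha_1,\alpha_2\in (0,1)$. Let $(x^{\mathrm{I}}_n)$ and $(x^{\mathrm{IM}}_n)$ be the two iterative sequences with the same initial point $x^{\mathrm{I}}_0=x^{\mathrm{IM}}_0=x_0 \in \Omega$ defined respectively, for $n\in\mathbb{N}$, by $$x^{\mathrm{I}}_{n+1} = (1-b_n)x^{\mathrm{I}}_n + b_nT_2\big((1-a_n)x^{\mathrm{I}}_n + a_nT_1(x^{\mathrm{I}}_n)\big)$$ and $$y_n=(1-a_n)x^{\mathrm{IM}}_n+a_nT_1(x^{\mathrm{IM}}_n),\qquad x^{\mathrm{IM}}_{n+1}=(1-b_n)y_n+b_nT_2(y_n).$$ Then $$\lim_{n \to \infty} x^{\mathrm{I}}_n=\lim_{n \to \infty} x^{\mathrm{IM}}_n=x^* \iff \sum_{k=0}^{\infty}b_k=+\infty.$$ Moreover, the sequence $(x^{\mathrm{IM}}_n)$ converges to $x^*$ faster than $(x^{\mathrm{I}}_n)$ under the following additional conditions: $$\sum_{k=0}^{\infty}b_k =+\infty \quad\text{and}\quad b_k \le \frac{(1-\alpha_1)a_k}{1+\alpha_2(1-a_k+\alpha_1 a_k)} \ \text{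 for every } k \in \mathbb{N}.$$
   Context: Banach spaces are real; $\mathbb{N}=\{0,1,2,\dots\}$. For $\alpha\in[0,1]$, $\mathbf{Ne}_{\alpha}(\Omega)$ is the set of maps $T:\Omega\to\Omega$ with $\|T(x)-T(y)\|\le\alpha\|x-y\|$ for all $x,y\in\Omega$. $\mathcal{F}(T_1,T_2)$ is the set of common fixed points, i.e. of $x^*\in\Omega$ with $T_1(x^* )=T_2(x^* )=x^*$. For $u,x,p\in\mathbb{X}$, $\mathcal{R}(u,x,p):=\|u-p\|/\|x-p\|$ if $x\neq p$; $\mathcal{R}(u,x,p):=1$ if $u\neq x=p$; $\mathcal{R}(u,x,p):=0$ if $u=x=p$. If $(u_n)$ and $(x_n)$ are sequences in $\mathbb{X}$ both converging to $p$, then $(u_n)$ is said to converge to $p$ faster than $(x_n)$ if $\lim_{n\to\infty}\mathcal{R}(u_n,x_n,p)=0$.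
   Formalization: The "only if" half of the equivalence is proved only when the Ishikawa sequence never equals x*; without this it is false (e.g. x_0 = x*, all b_k = 0). The "if" half and the "faster" claim are proved without this condition. *)

theory Defs
  imports "HOL-Analysis.Analysis"
begin

definition Ne :: "real \<Rightarrow> 'a::real_normed_vector set \<Rightarrow> ('a \<Rightarrow> 'a) set" where
  "Ne \<alpha> \<Omega> = {T. T \<in> \<Omega> \<rightarrow> \<Omega> \<and> (\<forall>x\<in>\<Omega>. \<forall>y\<in>\<Omega>. norm (T x - T y) \<le> \<alpha> * norm (x - y))}"

definition common_fixed_points :: "'a set \<Rightarrow> ('a \<Rightarrow> 'a) \<Rightarrow> ('a \<Rightarrow> 'a) \<Rightarrow> 'a set" where
  "common_fixed_points \<Omega> T1 T2 = {x \<in> \<Omega>. T1 x = x \<and> T2 x = x}"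

definition error_ratio :: "'a::real_normed_vector \<Rightarrow> 'a \<Rightarrow> 'a \<Rightarrow> real" where
  "error_ratio u x p =
     (if x \<noteq> p then norm (u - p) / norm (x - p) else if u \<noteq> x then 1 else 0)"

definition converges_faster ::
    "(nat \<Rightarrow> 'a::real_normed_vector) \<Rightarrow> (nat \<Rightarrow> 'a) \<Rightarrow> 'a \<Rightarrow> bool" where
  "converges_faster u x p \<longleftrightarrow>
     u \<longlonglongrightarrow> p \<and> x \<longlonglongrightarrow> p \<and> (\<lambda>n. error_ratio (u n) (x n) p) \<longlonglongrightarrow> 0"

definition ishikawa_iteration ::
    "(nat \<Rightarrow> real) \<Rightarrow> (nat \<Rightarrow> real) \<Rightarrow> ('a::real_vector \<Rightarrow> 'a) \<Rightarrow> ('a \<Rightarrow> 'a) \<Rightarrow> 'a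
      \<Rightarrow> (nat \<Rightarrow> 'a) \<Rightarrow> bool" where
  "ishikawa_iteration a b T1 T2 x0 x \<longleftrightarrow>
     x 0 = x0 \<and>
     (\<forall>n. x (Suc n) =
        (1 - b n) *\<^sub>R x n + b n *\<^sub>R T2 ((1 - a n) *\<^sub>R x n + a n *\<^sub>R T1 (x n)))"

definition modified_ishikawa_iteration ::
    "(nat \<Rightarrow> real) \<Rightarrow> (nat \<Rightarrow> real) \<Rightarrow> ('a::real_vector \<Rightarrow> 'a) \<Rightarrow> ('a \<Rightarrow> 'a) \<Rightarrow> 'a
      \<Rightarrow> (nat \<Rightarrow> 'a) \<Rightarrow> bool" where
  "modified_ishikawa_iteration a b T1 T2 x0 x \<longleftrightarrow>
     x 0 = x0 \<and>
     (\<forall>n. let y = (1 - a n) *\<^sub>R x n + a n *\<^sub>R T1 (x n)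
          in x (Suc n) = (1 - b n) *\<^sub>R y + b n *\<^sub>R T2 y)"

definition series_diverges_to_infinity :: "(nat \<Rightarrow> real) \<Rightarrow> bool" where
  "series_diverges_to_infinity b \<longleftrightarrow> filterlim (\<lambda>n. \<Sum>k\<le>n. b k) at_top sequentially"

text \<open>Convergence of both iterations does not by itself force the series of the \<open>b k\<close> to
  diverge: the Ishikawa sequence may reach the fixed point after finitely many steps, even when it
  starts elsewhere and every \<open>b k\<close> is less than 1. The necessity of divergence is therefore only
  meaningful for an Ishikawa sequence that never equals the fixed point.\<close>

lemma convergence_without_divergence:
  defines "b \<equiv> (\<lambda>n::nat. if n = 0 then 2/3 else 0 :: real)"
  defines "x \<equiv> (\<lambda>n::nat. if n = 0 then 1 else 0 :: real)"
  shows "(\<lambda>z::real. z / 2) \<in> Ne (1/2) UNIV" "(\<lambda>z::real. - z / 2) \<in> Ne (1/2) UNIV"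
    "0 \<in> common_fixed_points UNIV (\<lambda>z::real. z / 2) (\<lambda>z. - z / 2)"
    "\<And>n. 0 \<le> b n \<and> b n < 1"
    "ishikawa_iteration (\<lambda>n. 0) b (\<lambda>z. z / 2) (\<lambda>z. - z / 2) 1 x"
    "modified_ishikawa_iteration (\<lambda>n. 0) b (\<lambda>z. z / 2) (\<lambda>z. - z / 2) 1 x"
    "x \<longlonglongrightarrow> 0" "\<not> series_diverges_to_infinity b"
proof -
  show "(\<lambda>z::real. z / 2) \<in> Ne (1/2) UNIV" "(\<lambda>z::real. - z / 2) \<in> Ne (1/2) UNIV"
    "0 \<in> common_fixed_points UNIV (\<lambda>z::real. z / 2) (\<lambda>z. - z / 2)"
    "\<And>n. 0 \<le> b n \<and> b n < 1"
    "ishikawa_iteration (\<lambda>n. 0) b (\<lambda>z. z / 2) (\<lambda>z. - z / 2) 1 x"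
    "modified_ishikawa_iteration (\<lambda>n. 0) b (\<lambda>z. z / 2) (\<lambda>z. - z / 2) 1 x"
    by (auto simp: Ne_def common_fixed_points_def ishikawa_iteration_def
        modified_ishikawa_iteration_def b_def x_def abs_if field_simps)
  show "x \<longlonglongrightarrow> 0"
    by (rule tendsto_eventually, rule eventually_sequentiallyI[of 1]) (simp add: x_def)
  have "(\<lambda>n. \<Sum>k\<le>n. b k) = (\<lambda>n. 2/3)"
    by (simp add: b_def)
  then show "\<not> series_diverges_to_infinity b"
    unfolding series_diverges_to_infinity_def
    using not_tendsto_and_filterlim_at_infinity[of sequentially "\<lambda>n. 2/3::real" "2/3"]
    by (auto dest: filterlim_at_top_imp_at_infinity)
qed

end

theory Submission imports Defs begin

text \<open>Put \<open>c n = 1 - a n + \<alpha>1 * a n\<close> and measure both iterations by the distance to the common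
  fixed point. One Ishikawa step multiplies this distance by a factor between
  \<open>1 - b n * (1 + \<alpha>2 * c n)\<close> and \<open>1 - (1 - \<alpha>2) * b n\<close>, one modified step by at most
  \<open>(1 - (1 - \<alpha>2) * b n) * c n\<close>. Products of factors \<open>1 - d * b n\<close> tend to 0 when the
  series of the \<open>b n\<close> diverges; when it converges, their tails stay away from 0, so an Ishikawa
  sequence that never hits the fixed point cannot converge to it.
  The additional condition says exactly that \<open>1 - b n * (1 + \<alpha>2 * c n) \<ge> c n\<close>: the factor \<open>c n\<close>
  then cancels in the quotient of the distances, which again contracts by \<open>1 - (1 - \<alpha>2) * b n\<close>.\<close>

text \<open>Partial sums of nonnegative terms increase, so a single one above \<open>Z\<close> would
  keep all later ones above \<open>Z\<close>. A level \<open>Z\<close> witnessing the failure of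
  divergence therefore bounds all of them.\<close>

lemma summable_if_not_series_diverges_to_infinity:
  assumes nonneg: "\<And>n. 0 \<le> b n" and not_div: "\<not> series_diverges_to_infinity b"
  shows "summable b"
proof -
  obtain Z where Z: "\<not> (\<forall>\<^sub>F n in sequentially. Z \<le> (\<Sum>k\<le>n. b k))"
    using not_div by (auto simp: series_diverges_to_infinity_def filterlim_at_top)
  have "(\<Sum>k\<le>n. b k) \<le> Z" for n
  proof (rule ccontr)
    assume n: "\<not> (\<Sum>k\<le>n. b k) \<le> Z"
    have "Z \<le> (\<Sum>k\<le>m. b k)" if "n \<le> m" for m
      using n sum_mono2[of "{..m}" "{..n}" b] nonneg that by simp
    then show False
      using Z eventually_sequentiallyI[of n "\<lambda>m. Z \<le> (\<Sum>k\<le>m. b k)"] by blast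
  qed
  then show ?thesis
    by (intro bounded_imp_summable[where B = Z] nonneg)
qed

text \<open>By 1 - t \<le> exp (- t), the product of the step factors is dominated by one
  exponential, whose exponent tends to minus infinity.\<close>

lemma tendsto_zero_if_contraction_series_diverges:
  fixes u b :: "nat \<Rightarrow> real"
  assumes nonneg: "\<And>n. 0 \<le> u n" and "0 < d"
    and step: "\<And>n. u (Suc n) \<le> (1 - d * b n) * u n"
    and diverges: "series_diverges_to_infinity b"
  shows "u \<longlonglongrightarrow> 0"
proof -
  have bound: "u n \<le> u 0 * exp (- (d * (\<Sum>k<n. b k)))" for n
  proof (induction n)
    case (Suc n)
    have "u (Suc n) \<le> exp (- (d * b n)) * u n"
      using step[of n] exp_ge_add_one_self[of "- (d * b n)"] nonneg[of n]
      by (smt (verit) mult_right_mono)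
    also have "\<dots> \<le> exp (- (d * b n)) * (u 0 * exp (- (d * (\<Sum>k<n. b k))))"
      using Suc.IH by simp
    also have "\<dots> = u 0 * exp (- (d * (\<Sum>k<Suc n. b k)))"
      by (simp add: algebra_simps flip: exp_add)
    finally show ?case .
  qed simp
  \<comment> \<open>The definition of divergence sums up to and including \<open>n\<close>, the
    product bound only below \<open>n\<close>; shifting the index by one reconciles them.\<close>
  have "filterlim (\<lambda>n. \<Sum>k<n. b k) at_top sequentially"
    using diverges
    by (subst filterlim_sequentially_Suc[symmetric])
      (simp only: series_diverges_to_infinity_def lessThan_Suc_atMost)
  then have "filterlim (\<lambda>n. - (d * (\<Sum>k<n. b k))) at_bot sequentially"
    using \<open>0 < d\<close>
    by (simp add: filterlim_uminus_at_top[symmetric] filterlim_tendsto_pos_mult_at_top[OF tendsto_const])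
  then have "(\<lambda>n. u 0 * exp (- (d * (\<Sum>k<n. b k)))) \<longlonglongrightarrow> 0"
    using tendsto_mult_right_zero[OF filterlim_compose[OF exp_at_bot]] by blast
  then show ?thesis
    by (rule tendsto_sandwich[rotated 3, OF _ ]) (use nonneg bound in auto)
qed

text \<open>Start at an \<open>N\<close> beyond which \<open>s\<close> sums to at most 1/2. The
  Weierstrass inequality, that a product of factors 1 - s k is at least 1 minus the sum of the s k,
  then keeps \<open>u\<close> above half of \<open>u N\<close>.\<close>

lemma not_tendsto_zero_if_summable_decay:
  fixes u s :: "nat \<Rightarrow> real"
  assumes pos: "\<And>n. 0 < u n" and nonneg: "\<And>n. 0 \<le> s n" and "summable s"
    and step: "\<And>n. (1 - s n) * u n \<le> u (Suc n)"
  shows "\<not> u \<longlonglongrightarrow> 0"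
proof
  assume lim: "u \<longlonglongrightarrow> 0"
  obtain N where N: "\<And>n. N \<le> n \<Longrightarrow> norm (\<Sum>i. s (i + n)) < 1 / 2"
    using suminf_exist_split[of "1 / 2" s] \<open>summable s\<close> by auto
  have "summable (\<lambda>i. s (i + N))"
    using \<open>summable s\<close> by (simp add: summable_iff_shift)
  then have tail: "(\<Sum>k<n. s (k + N)) \<le> 1 / 2" for n
    using N[of N] sum_le_suminf[of "\<lambda>i. s (i + N)" "{..<n}"] nonneg by simp
  have bound: "(1 - (\<Sum>k<n. s (k + N))) * u N \<le> u (n + N)" for n
  proof (induction n)
    case (Suc n)
    let ?S = "\<Sum>k<n. s (k + N)"
    have S: "0 \<le> ?S"
      by (intro sum_nonneg nonneg)
    \<comment> \<open>The induction hypothesis can be multiplied by \<open>1 - s (n + N)\<close>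
      only if this factor is nonnegative.\<close>
    have s: "s (n + N) \<le> 1"
      using tail[of "Suc n"] S by simp
    have "1 - (\<Sum>k<Suc n. s (k + N)) \<le> (1 - s (n + N)) * (1 - ?S)"
      using mult_nonneg_nonneg[OF nonneg[of "n + N"] S] by (simp add: algebra_simps)
    then have "(1 - (\<Sum>k<Suc n. s (k + N))) * u N \<le> (1 - s (n + N)) * ((1 - ?S) * u N)"
      using pos[of N] by (simp add: mult_right_mono flip: mult.assoc)
    also have "\<dots> \<le> (1 - s (n + N)) * u (n + N)"
      using Suc.IH s by (intro mult_left_mono) auto
    also have "\<dots> \<le> u (Suc n + N)"
      using step[of "n + N"] by simp
    finally show ?case .
  qed simp
  have "1 / 2 * u N \<le> u (n + N)" for n
  proof -
    have "1 / 2 * u N \<le> (1 - (\<Sum>k<n. s (k + N))) * u N"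
      using tail[of n] pos[of N] by (intro mult_right_mono) auto
    then show ?thesis
      using bound[of n] by linarith
  qed
  then have "1 / 2 * u N \<le> 0"
    using LIMSEQ_le_const[OF LIMSEQ_ignore_initial_segment[OF lim, of N]] by blast
  then show False
    using pos[of N] by simp
qed

lemma norm_convex_combination_le:
  fixes u v p :: "'a::real_normed_vector"
  assumes "t \<in> {0..1}" and "norm (v - p) \<le> \<beta> * norm (u - p)"
  shows "norm ((1 - t) *\<^sub>R u + t *\<^sub>R v - p) \<le> (1 - t + t * \<beta>) * norm (u - p)"
proof -
  have "(1 - t) *\<^sub>R u + t *\<^sub>R v - p = (1 - t) *\<^sub>R (u - p) + t *\<^sub>R (v - p)"
    by (simp add: algebra_simps)
  then have "norm ((1 - t) *\<^sub>R u + t *\<^sub>R v - p) \<le> (1 - t) * norm (u - p) + t * norm (v - p)"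
    using assms(1) norm_triangle_ineq[of "(1 - t) *\<^sub>R (u - p)" "t *\<^sub>R (v - p)"] by simp
  also have "\<dots> \<le> (1 - t) * norm (u - p) + t * (\<beta> * norm (u - p))"
    using assms by (intro add_left_mono mult_left_mono) auto
  finally show ?thesis
    by (simp add: algebra_simps)
qed

text \<open>Counterpart of the preceding bound by the reverse triangle inequality: the second term
  can cancel at most t * \<beta> of the first.\<close>

lemma norm_convex_combination_ge:
  fixes u v p :: "'a::real_normed_vector"
  assumes "t \<in> {0..1}" and "norm (v - p) \<le> \<beta> * norm (u - p)"
  shows "(1 - t * (1 + \<beta>)) * norm (u - p) \<le> norm ((1 - t) *\<^sub>R u + t *\<^sub>R v - p)"
proof -
  have "(1 - t) *\<^sub>R u + t *\<^sub>R v - p = (1 - t) *\<^sub>R (u - p) + t *\<^sub>R (v - p)"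
    by (simp add: algebra_simps)
  then have "(1 - t) * norm (u - p) - t * norm (v - p) \<le> norm ((1 - t) *\<^sub>R u + t *\<^sub>R v - p)"
    using assms(1) norm_diff_ineq[of "(1 - t) *\<^sub>R (u - p)" "t *\<^sub>R (v - p)"] by simp
  moreover have "t * norm (v - p) \<le> t * (\<beta> * norm (u - p))"
    using assms by (intro mult_left_mono) auto
  ultimately show ?thesis
    by (simp add: algebra_simps)
qed

lemma Ne_norm_fixed_point_le:
  "T \<in> Ne \<alpha> \<Omega> \<Longrightarrow> T p = p \<Longrightarrow> p \<in> \<Omega> \<Longrightarrow> x \<in> \<Omega> \<Longrightarrow> norm (T x - p) \<le> \<alpha> * norm (x - p)"
  unfolding Ne_def by force

text \<open>Only the necessity of divergence requires an Ishikawa sequence that avoids the fixed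
  point; sufficiency is a conjunct of its own so that it holds without this restriction.\<close>

theorem theorem4p4:
  fixes \<Omega> :: "'a::banach set"
    and a b :: "nat \<Rightarrow> real"
    and T1 T2 :: "'a \<Rightarrow> 'a"
    and \<alpha>1 \<alpha>2 :: real
    and x0 xs :: 'a
    and xI xIM :: "nat \<Rightarrow> 'a"
  assumes "convex \<Omega>"
    and "\<And>n. a n \<in> {0..1}" and "\<And>n. b n \<in> {0..1}"
    and "\<alpha>1 \<in> {0<..<1}" and "\<alpha>2 \<in> {0<..<1}"
    and "T1 \<in> Ne \<alpha>1 \<Omega>" and "T2 \<in> Ne \<alpha>2 \<Omega>"
    and "xs \<in> common_fixed_points \<Omega> T1 T2"
    and "x0 \<in> \<Omega>"
    and "ishikawa_iteration a b T1 T2 x0 xI"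
    and "modified_ishikawa_iteration a b T1 T2 x0 xIM"
  shows "((\<forall>n. xI n \<noteq> xs) \<longrightarrow>
            (xI \<longlonglongrightarrow> xs \<and> xIM \<longlonglongrightarrow> xs \<longleftrightarrow> series_diverges_to_infinity b)) \<and>
         (series_diverges_to_infinity b \<longrightarrow> xI \<longlonglongrightarrow> xs \<and> xIM \<longlonglongrightarrow> xs) \<and>
         (series_diverges_to_infinity b \<and>
            (\<forall>k. b k \<le> (1 - \<alpha>1) * a k / (1 + \<alpha>2 * (1 - a k + \<alpha>1 * a k)))
            \<longrightarrow> converges_faster xIM xI xs)"
proof -
  define c where "c n = 1 - a n + \<alpha>1 * a n" for n
  define yI where "yI n = (1 - a n) *\<^sub>R xI n + a n *\<^sub>R T1 (xI n)" for n
  define yM where "yM n = (1 - a n) *\<^sub>R xIM n + a n *\<^sub>R T1 (xIM n)" for n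
  define e where "e n = norm (xI n - xs)" for n
  define f where "f n = norm (xIM n - xs)" for n
  have nonneg: "0 \<le> e n" "0 \<le> f n" for n
    by (simp_all add: e_def f_def)
  have a: "0 \<le> a n" "a n \<le> 1" and b: "0 \<le> b n" "b n \<le> 1" for n
    using assms(2,3)[of n] by auto
  have \<alpha>1: "0 < \<alpha>1" "\<alpha>1 < 1" and \<alpha>2: "0 < \<alpha>2" "\<alpha>2 < 1"
    using assms(4,5) by auto
  have xs: "xs \<in> \<Omega>" "T1 xs = xs" "T2 xs = xs"
    using assms(8) by (auto simp: common_fixed_points_def)
  have xI0: "xI 0 = x0" and xI_Suc: "\<And>n. xI (Suc n) = (1 - b n) *\<^sub>R xI n + b n *\<^sub>R T2 (yI n)"
    using assms(10) by (auto simp: ishikawa_iteration_def yI_def)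
  have xIM0: "xIM 0 = x0"
    and xIM_Suc: "\<And>n. xIM (Suc n) = (1 - b n) *\<^sub>R yM n + b n *\<^sub>R T2 (yM n)"
    using assms(11) by (auto simp: modified_ishikawa_iteration_def yM_def Let_def)
  have c: "\<alpha>1 \<le> c n" "c n \<le> 1" for n
  proof -
    have "0 \<le> (1 - \<alpha>1) * (1 - a n)" "0 \<le> (1 - \<alpha>1) * a n"
      using \<alpha>1 a[of n] by auto
    then show "\<alpha>1 \<le> c n" "c n \<le> 1"
      by (simp_all add: c_def algebra_simps)
  qed
  have comb: "(1 - t) *\<^sub>R x + t *\<^sub>R y \<in> \<Omega>" if "t \<in> {0..1}" "x \<in> \<Omega>" "y \<in> \<Omega>" for t x y
    using that \<open>convex \<Omega>\<close> by (simp add: convex_alt)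
  have T_in: "T1 x \<in> \<Omega>" "T2 x \<in> \<Omega>" if "x \<in> \<Omega>" for x
    using assms(6,7) that by (auto simp: Ne_def)
  \<comment> \<open>The Lipschitz bounds hold only on \<Omega>, so the iterates and the intermediate
    points must be shown to stay there.\<close>
  have xI_in: "xI n \<in> \<Omega>" for n
    by (induction n) (simp_all add: xI0 xI_Suc yI_def comb T_in assms(2,3,9) del: atLeastAtMost_iff)
  then have yI_in: "yI n \<in> \<Omega>" for n
    unfolding yI_def by (intro comb T_in assms(2))
  have xIM_in: "xIM n \<in> \<Omega>" for n
    by (induction n) (simp_all add: xIM0 xIM_Suc yM_def comb T_in assms(2,3,9) del: atLeastAtMost_iff)
  then have yM_in: "yM n \<in> \<Omega>" for n
    unfolding yM_def by (intro comb T_in assms(2))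
  have yI_le: "norm (yI n - xs) \<le> c n * e n" for n
    using norm_convex_combination_le[OF assms(2) Ne_norm_fixed_point_le[OF assms(6) xs(2,1) xI_in]]
    by (simp add: yI_def c_def e_def mult.commute)
  have yM_le: "norm (yM n - xs) \<le> c n * f n" for n
    using norm_convex_combination_le[OF assms(2) Ne_norm_fixed_point_le[OF assms(6) xs(2,1) xIM_in]]
    by (simp add: yM_def c_def f_def mult.commute)
  \<comment> \<open>The Ishikawa step averages with \<open>xI n\<close> rather than
    \<open>yI n\<close>, so the error is measured against \<open>xI n\<close>; this puts
    \<open>c n\<close> inside the factor instead of in front of it.\<close>
  have T2_yI_le: "norm (T2 (yI n) - xs) \<le> (\<alpha>2 * c n) * norm (xI n - xs)" for n
    using Ne_norm_fixed_point_le[OF assms(7) xs(3,1) yI_in[of n]] yI_le[of n] \<alpha>2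
    by (smt (verit, best) e_def mult.assoc mult_left_mono)
  have e_ge: "(1 - b n * (1 + \<alpha>2 * c n)) * e n \<le> e (Suc n)" for n
    using norm_convex_combination_ge[OF assms(3) T2_yI_le] by (simp add: e_def xI_Suc)
  have \<alpha>2c: "\<alpha>2 * c n \<le> \<alpha>2" for n
    using c[of n] \<alpha>2 by (simp add: mult_left_le)
  have e_le: "e (Suc n) \<le> (1 - (1 - \<alpha>2) * b n) * e n" for n
  proof -
    have "e (Suc n) \<le> (1 - b n + b n * (\<alpha>2 * c n)) * e n"
      using norm_convex_combination_le[OF assms(3) T2_yI_le] by (simp add: e_def xI_Suc)
    also have "\<dots> \<le> (1 - b n + b n * \<alpha>2) * e n"
      using \<alpha>2c[of n] b[of n] by (intro mult_right_mono add_left_mono mult_left_mono) (auto simp: e_def)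
    finally show ?thesis
      by (simp add: algebra_simps)
  qed
  have contraction: "0 \<le> 1 - (1 - \<alpha>2) * b n" for n
    using b[of n] \<alpha>2 mult_le_one[of "1 - \<alpha>2" "b n"] by simp
  have f_le: "f (Suc n) \<le> (1 - (1 - \<alpha>2) * b n) * (c n * f n)" for n
  proof -
    have "f (Suc n) \<le> (1 - b n + b n * \<alpha>2) * norm (yM n - xs)"
      using norm_convex_combination_le[OF assms(3) Ne_norm_fixed_point_le[OF assms(7) xs(3,1) yM_in]]
      by (simp add: f_def xIM_Suc)
    also have "\<dots> = (1 - (1 - \<alpha>2) * b n) * norm (yM n - xs)"
      by (simp add: algebra_simps)
    finally show ?thesis
      using mult_left_mono[OF yM_le contraction] order_trans by blast
  qed
  have f_le': "f (Suc n) \<le> (1 - (1 - \<alpha>2) * b n) * f n" for n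
  proof -
    have "c n * f n \<le> f n"
      using c[of n] by (simp add: f_def mult_left_le_one_le less_imp_le[OF less_le_trans[OF \<alpha>1(1)]])
    then show ?thesis
      using f_le[of n] mult_left_mono[OF _ contraction] order_trans by blast
  qed
  have lim_iff: "xI \<longlonglongrightarrow> xs \<longleftrightarrow> e \<longlonglongrightarrow> 0" "xIM \<longlonglongrightarrow> xs \<longleftrightarrow> f \<longlonglongrightarrow> 0"
    by (simp_all add: LIM_zero_iff tendsto_norm_zero_iff e_def[abs_def] f_def[abs_def])
  have sufficient: "xI \<longlonglongrightarrow> xs \<and> xIM \<longlonglongrightarrow> xs" if "series_diverges_to_infinity b"
    unfolding lim_iff
    using tendsto_zero_if_contraction_series_diverges[OF _ _ e_le that]
      tendsto_zero_if_contraction_series_diverges[OF _ _ f_le' that] nonneg \<alpha>2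
    by simp
  have necessary: "series_diverges_to_infinity b" if "xI \<longlonglongrightarrow> xs" "\<forall>n. xI n \<noteq> xs"
  proof (rule ccontr)
    assume "\<not> series_diverges_to_infinity b"
    \<comment> \<open>The constant 2 bounds \<open>1 + \<alpha>2 * c n\<close>.\<close>
    then have "summable (\<lambda>n. 2 * b n)"
      using summable_if_not_series_diverges_to_infinity b by (intro summable_mult) blast
    moreover have "(1 - 2 * b n) * e n \<le> e (Suc n)" for n
    proof -
      have "b n * (1 + \<alpha>2 * c n) \<le> b n * 2"
        using order_trans[OF \<alpha>2c less_imp_le[OF \<alpha>2(2)]] b by (intro mult_left_mono) simp_all
      then have "(1 - 2 * b n) * e n \<le> (1 - b n * (1 + \<alpha>2 * c n)) * e n"
        by (intro mult_right_mono) (auto simp: e_def)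
      then show ?thesis
        using e_ge[of n] by linarith
    qed
    ultimately have "\<not> e \<longlonglongrightarrow> 0"
      using that(2) b by (intro not_tendsto_zero_if_summable_decay[where s = "\<lambda>n. 2 * b n"]) (auto simp: e_def)
    then show False
      using that(1) lim_iff by blast
  qed
  have faster: "converges_faster xIM xI xs"
    if diverges: "series_diverges_to_infinity b"
      and small: "\<forall>k. b k \<le> (1 - \<alpha>1) * a k / (1 + \<alpha>2 * (1 - a k + \<alpha>1 * a k))"
  proof -
    have e_ge': "c n * e n \<le> e (Suc n)" for n
    proof -
      have "0 < 1 + \<alpha>2 * c n"
        using \<alpha>1 \<alpha>2 c[of n] by (intro add_pos_nonneg mult_nonneg_nonneg) auto
      then have "b n * (1 + \<alpha>2 * c n) \<le> (1 - \<alpha>1) * a n"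
        using small[rule_format, of n] by (simp only: c_def pos_le_divide_eq)
      \<comment> \<open>Here \<open>(1 - \<alpha>1) * a n\<close> equals
        \<open>1 - c n\<close>.\<close>
      then have "c n \<le> 1 - b n * (1 + \<alpha>2 * c n)"
        by (simp add: c_def[of n] algebra_simps)
      then show ?thesis
        using e_ge[of n] mult_right_mono[of "c n" _ "e n"] nonneg order_trans by blast
    qed
    have "(\<lambda>n. error_ratio (xIM n) (xI n) xs) \<longlonglongrightarrow> 0"
    \<comment> \<open>Starting at the fixed point, both sequences stay there and
      \<open>error_ratio\<close> takes its default value 0. Otherwise \<open>e_ge'\<close> and
      \<open>c n > 0\<close> keep every \<open>e n\<close> positive, so the ratio is a genuine
      quotient.\<close>
    proof (cases "x0 = xs")
      case True
      have "e n = 0" "f n = 0" for n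
      proof -
        show "e n = 0"
        proof (induction n)
          case (Suc n)
          then show ?case
            using e_le[of n] nonneg(1)[of "Suc n"] by simp
        qed (use True in \<open>simp add: e_def xI0\<close>)
        show "f n = 0"
        proof (induction n)
          case (Suc n)
          then show ?case
            using f_le'[of n] nonneg(2)[of "Suc n"] by simp
        qed (use True in \<open>simp add: f_def xIM0\<close>)
      qed
      then show ?thesis
        by (simp add: error_ratio_def e_def f_def)
    next
      case False
      have c_pos: "0 < c n" for n
        using c(1)[of n] \<alpha>1 by linarith
      have e_pos: "0 < e n" for n
      proof (induction n)
        case (Suc n)
        then show ?case
          using e_ge'[of n] mult_pos_pos[OF c_pos[of n]] by fastforce
      qed (use False in \<open>simp add: e_def xI0\<close>)
      have "f (Suc n) / e (Suc n) \<le> (1 - (1 - \<alpha>2) * b n) * (f n / e n)" for n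
      proof -
        \<comment> \<open>The upper bound for \<open>f\<close> and the lower bound for
          \<open>e\<close> both carry \<open>c n\<close>, which cancels and leaves a contraction
          with constant \<open>1 - \<alpha>2\<close>.\<close>
        have "f (Suc n) / e (Suc n) \<le> ((1 - (1 - \<alpha>2) * b n) * (c n * f n)) / (c n * e n)"
          using f_le e_ge' c_pos e_pos contraction[of n]
          by (intro frac_le mult_nonneg_nonneg) (auto simp: f_def less_imp_le)
        also have "\<dots> = (1 - (1 - \<alpha>2) * b n) * (f n / e n)"
          using c_pos[of n] by simp
        finally show ?thesis .
      qed
      then have "(\<lambda>n. f n / e n) \<longlonglongrightarrow> 0"
        by (intro tendsto_zero_if_contraction_series_diverges[OF _ _ _ diverges, of _ "1 - \<alpha>2"])
          (use \<alpha>2 nonneg in simp_all)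
      moreover have "error_ratio (xIM n) (xI n) xs = f n / e n" for n
        using e_pos[of n] by (auto simp: error_ratio_def e_def f_def)
      ultimately show ?thesis
        by simp
    qed
    then show ?thesis
      using sufficient[OF diverges] by (simp add: converges_faster_def)
  qed
  show ?thesis
    using sufficient necessary faster by blast
qed

end
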